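(* The map $\chi\mapsto\chi^g$ is a well-defined partial action of $G$ on the set $\widehat{\mathcal{B}}^+$, that is, for $\chi\in\widehat{\mathcal{B}}^+$ and $g,h\in G$: (i) if $\chi^g$ is defined, then $\chi^g(b)=\chi(a_g^*ba_g)/\chi(a_g^*a_g)$, $b\in\mathcal{B}$, does not depend on the choice of the element $a_g\in\mathcal{A}_g$ with $\chi(a_g^*a_g)\neq0$, and $\chi^g\in\widehat{\mathcal{B}}^+$; (ii) if $\chi^g$ and $(\chi^g)^h$ are defined, then $\chi^{hg}$ is defined and equal to $(\chi^g)^h$; (iii) if $\chi^g$ is defined, then $(\chi^g)^{g^{-1}}$ is defined and equal to $\chi$; (iv) $\chi^e$ is defined and equal to $\chi$.
   Context: $G$ is a discrete group with unit $e$ and $\mathcal{A}=\bigoplus_{g\in G}\mathcal{A}_g$ is a $G$-graded unital $*$-algebra (complex; $\mathcal{A}_g\mathcal{A}_h\subseteq\mathcal{A}_{gh}$, $(\mathcal{A}_g)^*\subseteq\mathcal{A}_{g^{-1}}$) such that the $*$-subalgebra $\mathcal{B}:=\mathcal{A}_e$ is commutative. $\sum\mathcal{A}^2$ is the set of finite sums of elements $a^*a$, $a\in\mathcal{A}$. $\widehat{\mathcal{B}}^+$ is the set of all characters (nontrivial $*$-homomorphisms $\chi:\mathcal{B}\to\mathbb{C}$) that are nonnegative on $\sum\mathcal{A}^2\cap\mathcal{B}$. Standing assumption of the section: $\chi(c^*d)\chi(d^*c)=\chi(c^*c)\chi(d^*d)$ for all $\chi\in\widehat{\mathcal{B}}^+$,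 $g\in G$, $c,d\in\mathcal{A}_g$. Definition: for $\chi\in\widehat{\mathcal{B}}^+$ and $g\in G$ one says that $\chi^g$ is defined if there exists $a_g\in\mathcal{A}_g$ with $\chi(a_g^*a_g)\neq0$; in this case $\chi^g(b):=\chi(a_g^*ba_g)/\chi(a_g^*a_g)$ for $b\in\mathcal{B}$. *)

theory Defs
  imports Complex_Main "HOL-Algebra.Group" "HOL-Library.Nonpos_Ints"
begin

text \<open>
  The sort \<open>{ring, monoid_mult}\<close> describes unital rings without the requirement \<open>0 \<noteq> 1\<close> that
  \<^class>\<open>ring_1\<close> imposes.
\<close>

locale star_algebra = vector_space scale
  for scale :: "complex \<Rightarrow> 'a::{ring,monoid_mult} \<Rightarrow> 'a" +
  fixes star :: "'a \<Rightarrow> 'a"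
  assumes scale_mult_left: "scale c x * y = scale c (x * y)"
    and scale_mult_right: "x * scale c y = scale c (x * y)"
    and star_add: "star (x + y) = star x + star y"
    and star_scale: "star (scale c x) = scale (cnj c) (star x)"
    and star_mult: "star (x * y) = star y * star x"
    and star_star: "star (star x) = x"

text \<open>
  Only the values \<open>A g\<close> with \<open>g \<in> carrier G\<close> matter; the decomposition of an element into
  homogeneous components is normalised to vanish outside the carrier, so that it is unique as
  a function.
\<close>

locale graded_star_algebra = group G + star_algebra scale star
  for G :: "'g monoid" (structure)
    and scale :: "complex \<Rightarrow> 'a::{ring,monoid_mult} \<Rightarrow> 'a"
    and star :: "'a \<Rightarrow> 'a" +
  fixes A :: "'g \<Rightarrow> 'a set"
  assumes subspace_A: "g \<in> carrier G \<Longrightarrow> subspace (A g)"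
    and direct_sum: "\<exists>!f. (\<forall>g\<in>carrier G. f g \<in> A g) \<and> (\<forall>g. g \<notin> carrier G \<longrightarrow> f g = 0)
          \<and> finite {g. f g \<noteq> 0} \<and> x = (\<Sum>g\<in>{g. f g \<noteq> 0}. f g)"
    and mult_A: "\<lbrakk>g \<in> carrier G; h \<in> carrier G; a \<in> A g; b \<in> A h\<rbrakk> \<Longrightarrow> a * b \<in> A (g \<otimes> h)"
    and star_A: "\<lbrakk>g \<in> carrier G; a \<in> A g\<rbrakk> \<Longrightarrow> star a \<in> A (inv g)"

definition sum_squares :: "('a::{ring,monoid_mult} \<Rightarrow> 'a) \<Rightarrow> 'a set" where
  "sum_squares star = {s. \<exists>(n::nat) a. s = (\<Sum>i<n. star (a i) * a i)}"

text \<open>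
  A character of \<open>B\<close> is represented by a function on the whole type that is \<^const>\<open>undefined\<close>
  outside \<open>B\<close>, so that equality of characters is equality of functions.
\<close>

definition characters ::
    "(complex \<Rightarrow> 'a::{ring,monoid_mult} \<Rightarrow> 'a) \<Rightarrow> ('a \<Rightarrow> 'a) \<Rightarrow> 'a set \<Rightarrow> ('a \<Rightarrow> complex) set" where
  "characters scale star B = {\<chi> \<in> extensional B.
     (\<forall>b\<in>B. \<forall>c\<in>B. \<chi> (b + c) = \<chi> b + \<chi> c) \<and>
     (\<forall>z. \<forall>b\<in>B. \<chi> (scale z b) = z * \<chi> b) \<and>
     (\<forall>b\<in>B. \<forall>c\<in>B. \<chi> (b * c) = \<chi> b * \<chi> c) \<and>
     (\<forall>b\<in>B. \<chi> (star b) = cnj (\<chi> b)) \<and>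
     (\<exists>b\<in>B. \<chi> b \<noteq> 0)}"

definition positive_characters ::
    "(complex \<Rightarrow> 'a::{ring,monoid_mult} \<Rightarrow> 'a) \<Rightarrow> ('a \<Rightarrow> 'a) \<Rightarrow> 'a set \<Rightarrow> ('a \<Rightarrow> complex) set" where
  "positive_characters scale star B =
     {\<chi> \<in> characters scale star B. \<forall>b\<in>sum_squares star \<inter> B. \<chi> b \<in> \<real>\<^sub>\<ge>\<^sub>0}"

definition act_defined ::
    "('a::{ring,monoid_mult} \<Rightarrow> 'a) \<Rightarrow> ('g \<Rightarrow> 'a set) \<Rightarrow> ('a \<Rightarrow> complex) \<Rightarrow> 'g \<Rightarrow> bool" where
  "act_defined star A \<chi> g \<longleftrightarrow> (\<exists>a\<in>A g. \<chi> (star a * a) \<noteq> 0)"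

text \<open>
  \<open>\<chi>\<^sup>g\<close>, computed with some admissible element \<open>a\<close> of \<open>A g\<close>. That the result does
  not depend on \<open>a\<close> is not part of the definition, and the value is meaningless unless
  \<^const>\<open>act_defined\<close> holds.
\<close>

definition act ::
    "('g, 'm) monoid_scheme \<Rightarrow> ('a::{ring,monoid_mult} \<Rightarrow> 'a) \<Rightarrow> ('g \<Rightarrow> 'a set)
       \<Rightarrow> ('a \<Rightarrow> complex) \<Rightarrow> 'g \<Rightarrow> 'a \<Rightarrow> complex" where
  "act G star A \<chi> g =
     (let a = (SOME a. a \<in> A g \<and> \<chi> (star a * a) \<noteq> 0)
      in (\<lambda>b\<in>A \<one>\<^bsub>G\<^esub>. \<chi> (star a * b * a) / \<chi> (star a * a)))"

end

theory Submission
  imports Defs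
begin

text \<open>
  Write \<open>B = A \<one>\<close>, and for \<open>a \<in> A g\<close> with \<open>\<chi> (star a * a) \<noteq> 0\<close> call
  \<open>b \<mapsto> \<chi> (star a * b * a) / \<chi> (star a * a)\<close> the twist of \<open>\<chi>\<close> by \<open>a\<close>. Everything rests on one
  remark: for \<open>a, c \<in> A g\<close> the element \<open>a * star c\<close> has degree \<open>\<one>\<close>, hence commutes with \<open>B\<close>. So in a
  product \<open>\<chi> (star u * b * a) * \<chi> (star c * v)\<close> with \<open>u, v \<in> A g\<close>, which by multiplicativity is
  \<open>\<chi> (star u * b * (a * star c) * v)\<close>, the element \<open>b\<close> can be moved from the first factor to the second
  (\<open>exchange\<close>). Applied with \<open>u\<close> and \<open>c\<close> equal to \<open>a\<close> and with \<open>v = b' * a\<close>, where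
  \<open>b' \<in> B\<close>, this shows that the twist by \<open>a\<close> is multiplicative; it is positive because conjugating a sum of squares gives a sum of squares.

  The exchange rule also shows that the twists by \<open>a\<close> and \<open>c\<close> agree as soon as
  \<open>\<chi> (star a * c) \<noteq> 0\<close> (\<open>twist_eqI\<close>). The standing assumption is an equality case of the
  Cauchy-Schwarz inequality, and it guarantees that any two admissible elements of the same degree satisfy this.
  Hence \<open>act\<close> is the twist by any admissible element, and the laws of a partial action come from
  multiplying the elements themselves: twisting by \<open>a\<close> and then by \<open>c\<close> is twisting by \<open>c * a\<close>,
  twisting by \<open>a\<close> and then by \<open>star a\<close> is the identity, and so is twisting by an element of \<open>B\<close>.
\<close>

section \<open>Twists of positive characters\<close>

definition (in graded_star_algebra) twist :: "('a \<Rightarrow> complex) \<Rightarrow> 'a \<Rightarrow> 'a \<Rightarrow> complex" where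
  "twist \<chi> a = (\<lambda>b\<in>A \<one>. \<chi> (star a * b * a) / \<chi> (star a * a))"

locale commutative_base_graded_star_algebra = graded_star_algebra G scale star A
  for G :: "'g monoid" (structure)
    and scale :: "complex \<Rightarrow> 'a::{ring,monoid_mult} \<Rightarrow> 'a"
    and star :: "'a \<Rightarrow> 'a"
    and A :: "'g \<Rightarrow> 'a set" +
  assumes base_commute: "\<lbrakk>b \<in> A \<one>; c \<in> A \<one>\<rbrakk> \<Longrightarrow> b * c = c * b"
begin

abbreviation "\<X> \<equiv> positive_characters scale star (A \<one>)"

lemma base_add: "\<lbrakk>b \<in> A \<one>; c \<in> A \<one>\<rbrakk> \<Longrightarrow> b + c \<in> A \<one>"
  using subspace_A[OF one_closed] by (rule subspace_add)

lemma base_scale: "b \<in> A \<one> \<Longrightarrow> scale z b \<in> A \<one>"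
  using subspace_A[OF one_closed] by (rule subspace_scale)

lemma base_mult: "\<lbrakk>b \<in> A \<one>; c \<in> A \<one>\<rbrakk> \<Longrightarrow> b * c \<in> A \<one>"
  using mult_A[of \<one> \<one> b c] by simp

lemma base_star: "b \<in> A \<one> \<Longrightarrow> star b \<in> A \<one>"
  using star_A[of \<one> b] by simp

lemma homogeneous_base_mult: "\<lbrakk>g \<in> carrier G; b \<in> A \<one>; a \<in> A g\<rbrakk> \<Longrightarrow> b * a \<in> A g"
  using mult_A[of \<one> g b a] by simp

lemma star_mult_in_base: "\<lbrakk>g \<in> carrier G; a \<in> A g; c \<in> A g\<rbrakk> \<Longrightarrow> star a * c \<in> A \<one>"
  using mult_A[of "inv g" g "star a" c] star_A[of g a] by simp

lemma mult_star_in_base: "\<lbrakk>g \<in> carrier G; a \<in> A g; c \<in> A g\<rbrakk> \<Longrightarrow> a * star c \<in> A \<one>"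
  using mult_A[of g "inv g" a "star c"] star_A[of g c] by simp

lemma conj_in_base: "\<lbrakk>g \<in> carrier G; a \<in> A g; c \<in> A g; b \<in> A \<one>\<rbrakk> \<Longrightarrow> star a * b * c \<in> A \<one>"
  using star_mult_in_base homogeneous_base_mult by (simp add: mult.assoc)

lemma star_conj: "star (star a * b * c) = star c * star b * a"
  by (simp add: star_mult star_star mult.assoc)

lemma sum_squares_conj:
  assumes "s \<in> sum_squares star"
  shows "star a * s * a \<in> sum_squares star"
proof -
  obtain n :: nat and x where s: "s = (\<Sum>i<n. star (x i) * x i)"
    using assms by (auto simp: sum_squares_def)
  have "star a * s * a = (\<Sum>i<n. star (x i * a) * (x i * a))"
    by (simp add: s sum_distrib_left sum_distrib_right star_mult mult.assoc)
  then show ?thesis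
    unfolding sum_squares_def by (intro CollectI exI[of _ n] exI[of _ "\<lambda>i. x i * a"])
qed

lemma square_in_sum_squares: "star a * a \<in> sum_squares star"
  unfolding sum_squares_def by (intro CollectI exI[of _ "1::nat"] exI[of _ "\<lambda>_. a"]) simp

context
  fixes \<chi>
  assumes \<chi>: "\<chi> \<in> \<X>"
begin

lemma positive_character:
  shows character_extensional: "\<chi> \<in> extensional (A \<one>)"
    and character_add: "\<lbrakk>b \<in> A \<one>; c \<in> A \<one>\<rbrakk> \<Longrightarrow> \<chi> (b + c) = \<chi> b + \<chi> c"
    and character_scale: "b \<in> A \<one> \<Longrightarrow> \<chi> (scale z b) = z * \<chi> b"
    and character_mult: "\<lbrakk>b \<in> A \<one>; c \<in> A \<one>\<rbrakk> \<Longrightarrow> \<chi> (b * c) = \<chi> b * \<chi> c"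
    and character_star: "b \<in> A \<one> \<Longrightarrow> \<chi> (star b) = cnj (\<chi> b)"
    and character_nontrivial: "\<exists>b\<in>A \<one>. \<chi> b \<noteq> 0"
    and character_nonneg: "\<lbrakk>b \<in> sum_squares star; b \<in> A \<one>\<rbrakk> \<Longrightarrow> \<chi> b \<in> \<real>\<^sub>\<ge>\<^sub>0"
  using \<chi> unfolding positive_characters_def characters_def by blast+

text \<open>
  The inner product \<open>a * star c\<close> of the concatenated word lies in the commutative algebra \<open>A \<one>\<close>, so \<open>b\<close>
  passes through it.
\<close>

lemma exchange:
  assumes "g \<in> carrier G" "u \<in> A g" "a \<in> A g" "c \<in> A g" "v \<in> A g" "b \<in> A \<one>"
  shows "\<chi> (star u * b * a) * \<chi> (star c * v) = \<chi> (star u * a) * \<chi> (star c * b * v)"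
proof -
  have "(star u * b * a) * (star c * v) = star u * (b * (a * star c)) * v"
    by (simp add: mult.assoc)
  also have "\<dots> = star u * ((a * star c) * b) * v"
    using assms base_commute mult_star_in_base by simp
  also have "\<dots> = (star u * a) * (star c * b * v)"
    by (simp add: mult.assoc)
  finally show ?thesis
    using assms
    by (simp flip: character_mult add: conj_in_base star_mult_in_base)
qed

lemma twist_in_positive_characters:
  assumes g: "g \<in> carrier G" and a: "a \<in> A g" and nz: "\<chi> (star a * a) \<noteq> 0"
  shows "twist \<chi> a \<in> \<X>"
proof -
  note conj = conj_in_base[OF g a a]
  have aa: "star a * a \<in> A \<one>"
    using g a by (intro star_mult_in_base)
  have nonneg: "\<chi> (star a * a) \<in> \<real>\<^sub>\<ge>\<^sub>0"
    using square_in_sum_squares aa by (rule character_nonneg)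
  have "twist \<chi> a (b + c) = twist \<chi> a b + twist \<chi> a c" if "b \<in> A \<one>" "c \<in> A \<one>" for b c
  proof -
    have "star a * (b + c) * a = star a * b * a + star a * c * a"
      by (simp add: algebra_simps)
    then show ?thesis
      using that conj by (simp add: twist_def base_add character_add add_divide_distrib)
  qed
  moreover have "twist \<chi> a (scale z b) = z * twist \<chi> a b" if "b \<in> A \<one>" for z b
    using that conj
    by (simp add: twist_def base_scale scale_mult_left scale_mult_right character_scale)
  moreover have "twist \<chi> a (b * c) = twist \<chi> a b * twist \<chi> a c" if b: "b \<in> A \<one>" and c: "c \<in> A \<one>" for b c
  proof -
    have ca: "c * a \<in> A g"
      using g c a by (rule homogeneous_base_mult)
    have "\<chi> (star a * b * a) * \<chi> (star a * (c * a)) = \<chi> (star a * a) * \<chi> (star a * b * (c * a))"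
      using exchange[OF g a a a ca b] .
    then show ?thesis
      using b c nz by (simp add: twist_def base_mult mult.assoc field_simps)
  qed
  moreover have "twist \<chi> a (star b) = cnj (twist \<chi> a b)" if "b \<in> A \<one>" for b
  proof -
    have "cnj (\<chi> (star a * a)) = \<chi> (star a * a)"
      using character_star[OF aa] by (simp add: star_mult star_star)
    moreover have "\<chi> (star a * star b * a) = cnj (\<chi> (star a * b * a))"
      using character_star[OF conj[OF that]] by (simp add: star_conj)
    ultimately show ?thesis
      using that by (simp add: twist_def base_star)
  qed
  moreover have "\<exists>b\<in>A \<one>. twist \<chi> a b \<noteq> 0"
  proof
    show "a * star a \<in> A \<one>"
      using g a by (intro mult_star_in_base)
    moreover have "\<chi> (star a * (a * star a) * a) = \<chi> (star a * a) * \<chi> (star a * a)"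
      using character_mult[OF aa aa] by (simp add: mult.assoc)
    ultimately show "twist \<chi> a (a * star a) \<noteq> 0"
      using nz by (simp add: twist_def)
  qed
  moreover have "twist \<chi> a b \<in> \<real>\<^sub>\<ge>\<^sub>0" if "b \<in> sum_squares star" "b \<in> A \<one>" for b
    using that nonneg conj sum_squares_conj
    by (simp add: twist_def character_nonneg nonneg_Reals_divide_I)
  ultimately show ?thesis
    by (auto simp: positive_characters_def characters_def twist_def)
qed

text \<open>
  Exchanging \<open>b\<close> once on either side expresses each of the two twists as the mixed quotient \<open>\<chi> (star a * b * c) / \<chi> (star a * c)\<close>.
\<close>

lemma twist_eqI:
  assumes "g \<in> carrier G" "a \<in> A g" "c \<in> A g"
    and nz: "\<chi> (star a * a) \<noteq> 0" "\<chi> (star c * c) \<noteq> 0" "\<chi> (star a * c) \<noteq> 0"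
  shows "twist \<chi> a = twist \<chi> c"
  unfolding twist_def
proof (rule restrict_ext)
  fix b assume b: "b \<in> A \<one>"
  have "\<chi> (star a * b * a) * \<chi> (star a * c) = \<chi> (star a * a) * \<chi> (star a * b * c)"
    using assms b by (intro exchange)
  then have "\<chi> (star a * b * a) / \<chi> (star a * a) = \<chi> (star a * b * c) / \<chi> (star a * c)"
    using nz by (simp add: field_simps)
  also have "\<chi> (star a * b * c) * \<chi> (star c * c) = \<chi> (star a * c) * \<chi> (star c * b * c)"
    using assms b by (intro exchange)
  then have "\<chi> (star a * b * c) / \<chi> (star a * c) = \<chi> (star c * b * c) / \<chi> (star c * c)"
    using nz by (simp add: field_simps)
  finally show "\<chi> (star a * b * a) / \<chi> (star a * a) = \<chi> (star c * b * c) / \<chi> (star c * c)" .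
qed

lemma twist_square:
  assumes "h \<in> carrier G" "c \<in> A h"
  shows "twist \<chi> a (star c * c) = \<chi> (star (c * a) * (c * a)) / \<chi> (star a * a)"
  using star_mult_in_base[OF assms(1,2,2)] by (simp add: twist_def star_mult mult.assoc)

lemma twist_twist:
  assumes h: "h \<in> carrier G" and c: "c \<in> A h" and nz: "\<chi> (star a * a) \<noteq> 0"
  shows "twist (twist \<chi> a) c = twist \<chi> (c * a)"
proof -
  have "twist \<chi> a (star c * b * c) / twist \<chi> a (star c * c)
      = \<chi> (star (c * a) * b * (c * a)) / \<chi> (star (c * a) * (c * a))" if "b \<in> A \<one>" for b
    using nz conj_in_base[OF h c c that]
    by (simp add: twist_square[OF h c]) (simp add: twist_def star_mult mult.assoc)
  then show ?thesis
    unfolding twist_def[of "twist \<chi> a"] twist_def[of \<chi> "c * a"] by (rule restrict_ext)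
qed

text \<open>
  An element of degree \<open>\<one>\<close> twists by the scalar \<open>\<chi> (star b * b)\<close>, which the normalisation cancels.
\<close>

lemma twist_base:
  assumes b: "b \<in> A \<one>" and nz: "\<chi> (star b * b) \<noteq> 0"
  shows "twist \<chi> b = \<chi>"
proof (rule extensionalityI)
  show "twist \<chi> b \<in> extensional (A \<one>)"
    by (simp add: twist_def)
  show "\<chi> \<in> extensional (A \<one>)"
    by (rule character_extensional)
  show "twist \<chi> b x = \<chi> x" if "x \<in> A \<one>" for x
    using that b nz by (simp add: twist_def character_mult base_mult base_star)
qed

lemma character_square_nonzero: "\<lbrakk>b \<in> A \<one>; \<chi> b \<noteq> 0\<rbrakk> \<Longrightarrow> \<chi> (star b * b) \<noteq> 0"
  using character_mult[of "star b" b] character_star[of b] base_star[of b] by simp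

end

end

section \<open>The partial action\<close>

locale cauchy_schwarz_graded_star_algebra = commutative_base_graded_star_algebra +
  assumes cauchy_schwarz_eq: "\<lbrakk>\<psi> \<in> \<X>; k \<in> carrier G; c \<in> A k; d \<in> A k\<rbrakk> \<Longrightarrow>
    \<psi> (star c * d) * \<psi> (star d * c) = \<psi> (star c * c) * \<psi> (star d * d)"
begin

lemma twist_unique:
  assumes "\<chi> \<in> \<X>" "g \<in> carrier G" "a \<in> A g" "c \<in> A g"
    and nz: "\<chi> (star a * a) \<noteq> 0" "\<chi> (star c * c) \<noteq> 0"
  shows "twist \<chi> a = twist \<chi> c"
proof -
  have "\<chi> (star a * c) \<noteq> 0"
    using cauchy_schwarz_eq[OF assms(1-4)] nz by auto
  with assms show ?thesis
    by (intro twist_eqI)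
qed

lemma act_eq_twist:
  assumes "\<chi> \<in> \<X>" "g \<in> carrier G" "a \<in> A g" "\<chi> (star a * a) \<noteq> 0"
  shows "act G star A \<chi> g = twist \<chi> a"
proof -
  define c where "c = (SOME c. c \<in> A g \<and> \<chi> (star c * c) \<noteq> 0)"
  have c: "c \<in> A g \<and> \<chi> (star c * c) \<noteq> 0"
    unfolding c_def by (rule someI[of _ a]) (simp add: assms)
  have "act G star A \<chi> g = twist \<chi> c"
    by (simp add: act_def c_def twist_def Let_def)
  also have "\<dots> = twist \<chi> a"
    using assms c by (intro twist_unique) auto
  finally show ?thesis .
qed

lemma act_in_positive_characters:
  assumes "\<chi> \<in> \<X>" "g \<in> carrier G" "act_defined star A \<chi> g"
  shows "act G star A \<chi> g \<in> \<X>"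
proof -
  obtain a where "a \<in> A g" "\<chi> (star a * a) \<noteq> 0"
    using assms by (auto simp: act_defined_def)
  with assms show ?thesis
    by (simp add: act_eq_twist twist_in_positive_characters)
qed

lemma act_act:
  assumes \<chi>: "\<chi> \<in> \<X>" and g: "g \<in> carrier G" and h: "h \<in> carrier G"
    and "act_defined star A \<chi> g" "act_defined star A (act G star A \<chi> g) h"
  shows "act_defined star A \<chi> (h \<otimes> g)"
    and "act G star A \<chi> (h \<otimes> g) = act G star A (act G star A \<chi> g) h"
proof -
  obtain a where a: "a \<in> A g" "\<chi> (star a * a) \<noteq> 0"
    using assms by (auto simp: act_defined_def)
  have act_g: "act G star A \<chi> g = twist \<chi> a"
    using \<chi> g a by (rule act_eq_twist)
  obtain c where c: "c \<in> A h" "twist \<chi> a (star c * c) \<noteq> 0"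
    using assms by (auto simp: act_defined_def act_g)
  have ca: "c * a \<in> A (h \<otimes> g)"
    using h g c(1) a(1) by (rule mult_A)
  have nz: "\<chi> (star (c * a) * (c * a)) \<noteq> 0"
    using twist_square[OF \<chi> h c(1), of a] c(2) by auto
  show "act_defined star A \<chi> (h \<otimes> g)"
    using ca nz by (auto simp: act_defined_def)
  have "act G star A \<chi> (h \<otimes> g) = twist \<chi> (c * a)"
    using \<chi> g h ca nz by (intro act_eq_twist) auto
  also have "\<dots> = twist (twist \<chi> a) c"
    using twist_twist[OF \<chi> h c(1) a(2)] by simp
  also have "\<dots> = act G star A (twist \<chi> a) h"
    using twist_in_positive_characters[OF \<chi> g a] h c by (rule act_eq_twist[symmetric])
  finally show "act G star A \<chi> (h \<otimes> g) = act G star A (act G star A \<chi> g) h"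
    by (simp add: act_g)
qed

lemma act_one:
  assumes \<chi>: "\<chi> \<in> \<X>"
  shows "act_defined star A \<chi> \<one>" and "act G star A \<chi> \<one> = \<chi>"
proof -
  obtain b where b: "b \<in> A \<one>" "\<chi> b \<noteq> 0"
    using character_nontrivial[OF \<chi>] by blast
  then have nz: "\<chi> (star b * b) \<noteq> 0"
    by (rule character_square_nonzero[OF \<chi>])
  show "act_defined star A \<chi> \<one>"
    using b(1) nz by (auto simp: act_defined_def)
  show "act G star A \<chi> \<one> = \<chi>"
    using act_eq_twist[OF \<chi> one_closed b(1) nz] twist_base[OF \<chi> b(1) nz] by simp
qed

text \<open>
  If \<open>a\<close> is admissible for \<open>\<chi>\<close>, then \<open>star a\<close> is admissible for the twist by \<open>a\<close>, because
  the product \<open>star a * a\<close> has degree \<open>\<one>\<close> and a nonzero value under \<open>\<chi>\<close>. That the result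
  is \<open>\<chi>\<close> is the composition law together with the trivial action of \<open>\<one>\<close>.
\<close>

lemma act_inv:
  assumes \<chi>: "\<chi> \<in> \<X>" and g: "g \<in> carrier G" and "act_defined star A \<chi> g"
  shows "act_defined star A (act G star A \<chi> g) (inv g)"
    and "act G star A (act G star A \<chi> g) (inv g) = \<chi>"
proof -
  obtain a where a: "a \<in> A g" "\<chi> (star a * a) \<noteq> 0"
    using assms by (auto simp: act_defined_def)
  have aa: "star a * a \<in> A \<one>"
    using g a(1) by (intro star_mult_in_base)
  have star_a: "star a \<in> A (inv g)"
    using g a(1) by (rule star_A)
  have "twist \<chi> a (star (star a) * star a) \<noteq> 0"
    using twist_square[OF \<chi> _ star_a, of a] g a(2) character_square_nonzero[OF \<chi> aa a(2)] by simp
  then show *: "act_defined star A (act G star A \<chi> g) (inv g)"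
    using star_a act_eq_twist[OF \<chi> g a] by (auto simp: act_defined_def)
  show "act G star A (act G star A \<chi> g) (inv g) = \<chi>"
    using act_act(2)[OF \<chi> g inv_closed[OF g] assms(3) *] act_one(2)[OF \<chi>] g by simp
qed

end

theorem proposition13:
  fixes G :: "'g monoid"
    and scale :: "complex \<Rightarrow> 'a::{ring,monoid_mult} \<Rightarrow> 'a"
    and star :: "'a \<Rightarrow> 'a"
    and A :: "'g \<Rightarrow> 'a set"
    and \<chi> :: "'a \<Rightarrow> complex"
    and g h :: 'g
  assumes graded: "graded_star_algebra G scale star A"
    and commutative: "\<And>b c. b \<in> A \<one>\<^bsub>G\<^esub> \<Longrightarrow> c \<in> A \<one>\<^bsub>G\<^esub> \<Longrightarrow> b * c = c * b"
    and standing: "\<And>\<psi> k c d. \<psi> \<in> positive_characters scale star (A \<one>\<^bsub>G\<^esub>) \<Longrightarrow>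
       k \<in> carrier G \<Longrightarrow> c \<in> A k \<Longrightarrow> d \<in> A k \<Longrightarrow>
       \<psi> (star c * d) * \<psi> (star d * c) = \<psi> (star c * c) * \<psi> (star d * d)"
    and \<chi>: "\<chi> \<in> positive_characters scale star (A \<one>\<^bsub>G\<^esub>)"
    and g: "g \<in> carrier G"
    and h: "h \<in> carrier G"
  shows "(act_defined star A \<chi> g \<longrightarrow>
           (\<forall>a\<in>A g. \<forall>a'\<in>A g. \<chi> (star a * a) \<noteq> 0 \<longrightarrow> \<chi> (star a' * a') \<noteq> 0 \<longrightarrow>
              (\<forall>b\<in>A \<one>\<^bsub>G\<^esub>. \<chi> (star a * b * a) / \<chi> (star a * a)
                          = \<chi> (star a' * b * a') / \<chi> (star a' * a'))) \<and>
           (\<forall>a\<in>A g. \<chi> (star a * a) \<noteq> 0 \<longrightarrow>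
              (\<forall>b\<in>A \<one>\<^bsub>G\<^esub>. act G star A \<chi> g b = \<chi> (star a * b * a) / \<chi> (star a * a))) \<and>
           act G star A \<chi> g \<in> positive_characters scale star (A \<one>\<^bsub>G\<^esub>)) \<and>
         (act_defined star A \<chi> g \<and> act_defined star A (act G star A \<chi> g) h \<longrightarrow>
           act_defined star A \<chi> (h \<otimes>\<^bsub>G\<^esub> g) \<and>
           act G star A \<chi> (h \<otimes>\<^bsub>G\<^esub> g) = act G star A (act G star A \<chi> g) h) \<and>
         (act_defined star A \<chi> g \<longrightarrow>
           act_defined star A (act G star A \<chi> g) (inv\<^bsub>G\<^esub> g) \<and>
           act G star A (act G star A \<chi> g) (inv\<^bsub>G\<^esub> g) = \<chi>) \<and>
         (act_defined star A \<chi> \<one>\<^bsub>G\<^esub> \<and> act G star A \<chi> \<one>\<^bsub>G\<^esub> = \<chi>)"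
proof -
  interpret cauchy_schwarz_graded_star_algebra G scale star A
    using graded commutative standing
    by (simp add: cauchy_schwarz_graded_star_algebra_def commutative_base_graded_star_algebra_def
        cauchy_schwarz_graded_star_algebra_axioms_def commutative_base_graded_star_algebra_axioms_def)
  have act_apply: "act G star A \<chi> g b = \<chi> (star a * b * a) / \<chi> (star a * a)"
    if "a \<in> A g" "\<chi> (star a * a) \<noteq> 0" "b \<in> A \<one>\<^bsub>G\<^esub>" for a b
    using act_eq_twist[OF \<chi> g that(1,2)] that(3) by (simp add: twist_def)
  show ?thesis
  proof (intro conjI impI ballI)
    fix a a' b
    assume "a \<in> A g" "a' \<in> A g" "\<chi> (star a * a) \<noteq> 0" "\<chi> (star a' * a') \<noteq> 0" "b \<in> A \<one>\<^bsub>G\<^esub>"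
    then show "\<chi> (star a * b * a) / \<chi> (star a * a) = \<chi> (star a' * b * a') / \<chi> (star a' * a')"
      using act_apply[of a b] act_apply[of a' b] by simp
  qed (use \<chi> g h act_apply in \<open>simp_all add: act_in_positive_characters act_act act_inv act_one\<close>)
qed

end
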